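(* Let $n\ge 1$, let $q_1,q_2,\dots,q_n\ge 0$ be integers, and let $B$ be a commutative group. Identify maps $\mathbb{Z}_{q_1}\times\dots\times\mathbb{Z}_{q_n}\to B$ with $(q_1,\dots,q_n)$-periodic maps $\mathbb{Z}^n\to B$. Then the functions $f\colon\mathbb{Z}_{q_1}\times\mathbb{Z}_{q_2}\times\dots\times\mathbb{Z}_{q_n}\to B$ with $\mathrm{Fdeg}(f)<\infty$ are exactly the functions that are given by $(q_1,q_2,\dots,q_n)$-periodic $B$-polyfracts. Moreover, if such an $f$ is written as a polyfract, having total degree $\deg(f)$ and partial degrees $\deg_i(f)$, then $$\mathrm{Fdeg}(f)=\deg(f)\quad\text{and}\quad \mathrm{Pdeg}_i(f)=\deg_i(f)\quad\text{for } i=1,2,\dots,n.$$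
   Context: $\mathbb{N}$ contains $0$; $\mathbb{Z}_q=\mathbb{Z}/q\mathbb{Z}$, with $\mathbb{Z}_1=\{0\}$ and $\mathbb{Z}_0=\mathbb{Z}$. Let $A=\mathbb{Z}_{q_1}\times\dots\times\mathbb{Z}_{q_n}$ and let $e_i\in A$ be the tuple with (the class of) $1$ in position $i$ and $0$ elsewhere. For $f\colon A\to B$ put $[\Delta_i f](x):=f(x+e_i)-f(x)$. The functional degree $\mathrm{Fdeg}(f)$ is the smallest integer $m\ge0$ such that $\Delta_1^{d_1}\Delta_2^{d_2}\cdots\Delta_n^{d_n}f\equiv0$ for all integers $d_1,\dots,d_n\ge0$ with $\sum_i d_i>m$, if such an $m$ exists, and $\infty$ otherwise. The $i$-th partial functional degree $\mathrm{Pdeg}_i(f)$ is the smallest integer $m\ge0$ such that $\Delta_i^{m+1}f\equiv0$, if such an $m$ exists, and $\infty$ otherwise. A map $F\colon\mathbb{Z}^n\to B$ is $(q_1,\dots,q_n)$-periodic if $F(x+q_ie_i)=F(x)$ for all $x\in\mathbb{Z}^n$ and all $i$. A map $f\colon A\to B$ is identified with the $(q_1,\dots,q_n)$-periodic map $\mathbb{Z}^n\to B$, $(x_1,\dots,x_n)\mapsto f(x_1+q_1\mathbb{Z},\dots,x_n+q_n\mathbb{Z})$; this is a bijection from $B^A$ onto the periodic maps. A $B$-polyfract is a formal finite sum $P=\sum_{\delta\in\mathbb{N}^n}b_\delta\binom{X_1}{\delta_1}\binom{X_2}{\delta_2}\cdots\binom{X_n}{\delta_n}$ with coefficients $b_\delta\in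 B$, only finitely many of them nonzero, where $\binom{X}{\delta}=\frac{X(X-1)\cdots(X-\delta+1)}{\delta!}$ and $\binom{X}{0}=1$. It gives the map $\mathbb{Z}^n\to B$, $x\mapsto\sum_\delta b_\delta\binom{x_1}{\delta_1}\cdots\binom{x_n}{\delta_n}$, where integers act on $B$ by the $\mathbb{Z}$-module structure; different polyfracts give different maps, and a polyfract is identified with its map. For $P\ne0$, $\deg(P):=\max_{b_\delta\ne0}(\delta_1+\dots+\delta_n)$ and $\deg_i(P):=\max_{b_\delta\neq0}\delta_i$; also $\deg(0):=0$ and $\deg_i(0):=0$. *)

theory Defs
  imports "HOL-Algebra.Product_Groups" "HOL-Library.Poly_Mapping" "HOL-Library.Extended_Nat"
begin

text \<open>
  The coordinates of all tuples are indexed by \<open>{1..n}\<close>. A residue class in \<open>\<int>\<^sub>q\<close> is represented by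
  the value \<open>x mod q\<close>, as in \<^const>\<open>integer_mod_group\<close>; since \<open>x mod 0 = x\<close>, this includes
  \<open>\<int>\<^sub>0 = \<int>\<close>.
\<close>

definition domain_group :: "nat \<Rightarrow> (nat \<Rightarrow> nat) \<Rightarrow> (nat \<Rightarrow> int) monoid" where
  "domain_group n q = product_group {1..n} (\<lambda>i. integer_mod_group (q i))"

definition unit_tuple :: "nat \<Rightarrow> (nat \<Rightarrow> nat) \<Rightarrow> nat \<Rightarrow> nat \<Rightarrow> int" where
  "unit_tuple n q i = (\<lambda>j\<in>{1..n}. if j = i then 1 mod int (q j) else 0)"

definition maps :: "nat \<Rightarrow> (nat \<Rightarrow> nat) \<Rightarrow> ((nat \<Rightarrow> int) \<Rightarrow> 'b) set" where
  "maps n q = carrier (domain_group n q) \<rightarrow>\<^sub>E UNIV"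

text \<open>Only the values of \<open>\<Delta> n q i f\<close> on the carrier of the domain group are meaningful.\<close>

definition \<Delta> ::
  "nat \<Rightarrow> (nat \<Rightarrow> nat) \<Rightarrow> nat \<Rightarrow> ((nat \<Rightarrow> int) \<Rightarrow> 'b::ab_group_add) \<Rightarrow> (nat \<Rightarrow> int) \<Rightarrow> 'b" where
  "\<Delta> n q i f = (\<lambda>x. f (x \<otimes>\<^bsub>domain_group n q\<^esub> unit_tuple n q i) - f x)"

definition iterated_\<Delta> ::
  "nat \<Rightarrow> (nat \<Rightarrow> nat) \<Rightarrow> (nat \<Rightarrow> nat) \<Rightarrow> ((nat \<Rightarrow> int) \<Rightarrow> 'b::ab_group_add) \<Rightarrow> (nat \<Rightarrow> int) \<Rightarrow> 'b" where
  "iterated_\<Delta> n q d f = foldr (\<lambda>i. \<Delta> n q i ^^ d i) [1..<Suc n] f"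

definition vanishes :: "nat \<Rightarrow> (nat \<Rightarrow> nat) \<Rightarrow> ((nat \<Rightarrow> int) \<Rightarrow> 'b::zero) \<Rightarrow> bool" where
  "vanishes n q f \<longleftrightarrow> (\<forall>x\<in>carrier (domain_group n q). f x = 0)"

definition least_or_infinity :: "(nat \<Rightarrow> bool) \<Rightarrow> enat" where
  "least_or_infinity Q = (if \<exists>m. Q m then enat (LEAST m. Q m) else \<infinity>)"

definition Fdeg ::
  "nat \<Rightarrow> (nat \<Rightarrow> nat) \<Rightarrow> ((nat \<Rightarrow> int) \<Rightarrow> 'b::ab_group_add) \<Rightarrow> enat" where
  "Fdeg n q f = least_or_infinity
     (\<lambda>m. \<forall>d :: nat \<Rightarrow> nat. (\<Sum>i\<in>{1..n}. d i) > m \<longrightarrow> vanishes n q (iterated_\<Delta> n q d f))"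

definition Pdeg ::
  "nat \<Rightarrow> (nat \<Rightarrow> nat) \<Rightarrow> nat \<Rightarrow> ((nat \<Rightarrow> int) \<Rightarrow> 'b::ab_group_add) \<Rightarrow> enat" where
  "Pdeg n q i f = least_or_infinity (\<lambda>m. vanishes n q ((\<Delta> n q i ^^ (m + 1)) f))"

definition int_tuples :: "nat \<Rightarrow> (nat \<Rightarrow> int) set" where
  "int_tuples n = ({1..n} \<rightarrow>\<^sub>E UNIV)"

definition periodic :: "nat \<Rightarrow> (nat \<Rightarrow> nat) \<Rightarrow> ((nat \<Rightarrow> int) \<Rightarrow> 'b) \<Rightarrow> bool" where
  "periodic n q F \<longleftrightarrow> (\<forall>x\<in>int_tuples n. \<forall>i\<in>{1..n}. F (x(i := x i + int (q i))) = F x)"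

text \<open>The identification of maps on the product of the \<open>\<int>\<^bsub>q i\<^esub>\<close> with periodic maps on \<open>\<int>\<^sup>n\<close>.\<close>

definition periodic_lift ::
  "nat \<Rightarrow> (nat \<Rightarrow> nat) \<Rightarrow> ((nat \<Rightarrow> int) \<Rightarrow> 'b) \<Rightarrow> (nat \<Rightarrow> int) \<Rightarrow> 'b" where
  "periodic_lift n q f = (\<lambda>x\<in>int_tuples n. f (\<lambda>i\<in>{1..n}. x i mod int (q i)))"

definition int_scale :: "int \<Rightarrow> 'b::ab_group_add \<Rightarrow> 'b" where
  "int_scale k b = (if k \<ge> 0 then (\<Sum>j<nat k. b) else - (\<Sum>j<nat (- k). b))"

text \<open>
  The division is exact. This is the definition of \<open>gchoose\<close> on the integers, spelled out because
  the sort constraint on that constant admits only fields here.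
\<close>

definition int_choose :: "int \<Rightarrow> nat \<Rightarrow> int" where
  "int_choose x k = (\<Prod>j=0..<k. x - int j) div fact k"

text \<open>
  A polyfract is the finitely supported family of its coefficients \<open>b\<^sub>\<delta>\<close>. The multi-exponents
  \<open>\<delta> \<in> \<nat>\<^sup>n\<close> are the finitely supported \<open>\<delta> :: nat \<Rightarrow>\<^sub>0 nat\<close> with support in \<open>{1..n}\<close>.
\<close>

definition polyfracts :: "nat \<Rightarrow> ((nat \<Rightarrow>\<^sub>0 nat) \<Rightarrow>\<^sub>0 'b::ab_group_add) set" where
  "polyfracts n = {P. \<forall>\<delta>\<in>Poly_Mapping.keys P. Poly_Mapping.keys \<delta> \<subseteq> {1..n}}"

definition polyfract_map ::
  "nat \<Rightarrow> ((nat \<Rightarrow>\<^sub>0 nat) \<Rightarrow>\<^sub>0 'b::ab_group_add) \<Rightarrow> (nat \<Rightarrow> int) \<Rightarrow> 'b" where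
  "polyfract_map n P = (\<lambda>x\<in>int_tuples n. \<Sum>\<delta>\<in>Poly_Mapping.keys P.
     int_scale (\<Prod>i\<in>{1..n}. int_choose (x i) (Poly_Mapping.lookup \<delta> i)) (Poly_Mapping.lookup P \<delta>))"

definition total_deg :: "nat \<Rightarrow> ((nat \<Rightarrow>\<^sub>0 nat) \<Rightarrow>\<^sub>0 'b::ab_group_add) \<Rightarrow> nat" where
  "total_deg n P = (if P = 0 then 0 else
     Max ((\<lambda>\<delta>. \<Sum>i\<in>{1..n}. Poly_Mapping.lookup \<delta> i) ` Poly_Mapping.keys P))"

definition partial_deg :: "nat \<Rightarrow> ((nat \<Rightarrow>\<^sub>0 nat) \<Rightarrow>\<^sub>0 'b::ab_group_add) \<Rightarrow> nat" where
  "partial_deg i P = (if P = 0 then 0 else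
     Max ((\<lambda>\<delta>. Poly_Mapping.lookup \<delta> i) ` Poly_Mapping.keys P))"

end

theory Submission
  imports Defs
begin

text \<open>
  A map \<open>f\<close> on \<open>\<int>\<^bsub>q 1\<^esub> \<times> \<dots> \<times> \<int>\<^bsub>q n\<^esub>\<close> is studied through its pullback \<open>F\<close> to integer points, on
  which \<open>\<Delta>\<close> becomes the ordinary forward difference \<open>D\<^sub>i\<close>. By Pascal's rule, \<open>D\<^sub>i\<close> lowers the \<open>i\<close>-th
  exponent of a product \<open>\<Prod>i. x i choose \<delta> i\<close> by one, or kills the product if that exponent is \<open>0\<close>;
  at the origin only the product with all exponents \<open>0\<close> survives. Thus the mixed difference of
  order \<open>\<delta>\<close> of a polyfract, evaluated at the origin, is precisely the coefficient \<open>b\<^sub>\<delta>\<close>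
  (\<open>mixed_diff_polyfract_fun_origin\<close>), and both degree formulas follow: a difference of
  order above the degree kills every term, while a nonzero coefficient of maximal degree survives
  as the value of a difference of that order.

  Conversely, if all mixed differences of \<open>F\<close> of order greater than \<open>m\<close> vanish, then the Newton
  polyfract \<open>\<Sum>\<delta>. (D\<^sup>\<delta> F)(0) \<Prod>i. x i choose \<delta> i\<close>, taken over \<open>\<bar>\<delta>\<bar> \<le> m\<close>, has the same mixed
  differences as \<open>F\<close> at the origin and above order \<open>m\<close>. Descending induction on the order
  then shows that it equals \<open>F\<close>, since two functions with the same first differences and the same
  value at the origin agree (\<open>eq_if_mixed_diff_eq\<close>).

  What remains is the dictionary between periodic maps on \<open>\<int>\<^sup>n\<close> and maps on the product.
  Functions are taken on all of \<open>nat \<Rightarrow> int\<close>, of which only the coordinates in \<open>{1..n}\<close> matter, so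
  that equality of functions replaces equality on \<open>\<int>\<^sup>n\<close>.
\<close>

text \<open>
  The list \<open>[1..<Suc n]\<close> stands for the set of all coordinates; splitting off its last entry would
  only obscure this.
\<close>

declare upt_Suc [simp del]

section \<open>Forward differences on integer points\<close>

definition fdiff :: "'i \<Rightarrow> (('i \<Rightarrow> int) \<Rightarrow> 'b::ab_group_add) \<Rightarrow> ('i \<Rightarrow> int) \<Rightarrow> 'b" where
  "fdiff i F = (\<lambda>x. F (x(i := x i + 1)) - F x)"

definition mixed_diff ::
  "'i list \<Rightarrow> ('i \<Rightarrow> nat) \<Rightarrow> (('i \<Rightarrow> int) \<Rightarrow> 'b::ab_group_add) \<Rightarrow> ('i \<Rightarrow> int) \<Rightarrow> 'b" where
  "mixed_diff l d F = foldr (\<lambda>i. fdiff i ^^ d i) l F"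

lemma mixed_diff_Nil [simp]: "mixed_diff [] d F = F"
  by (simp add: mixed_diff_def)

lemma mixed_diff_Cons [simp]: "mixed_diff (i # l) d F = (fdiff i ^^ d i) (mixed_diff l d F)"
  by (simp add: mixed_diff_def)

lemma mixed_diff_cong: "(\<And>i. i \<in> set l \<Longrightarrow> d i = d' i) \<Longrightarrow> mixed_diff l d F = mixed_diff l d' F"
  by (induction l) auto

lemma mixed_diff_order_zero: "mixed_diff l (\<lambda>_. 0) F = F"
  by (induction l) auto

lemma fdiff_zero [simp]: "fdiff i (\<lambda>_. 0) = (\<lambda>_. 0)"
  by (simp add: fdiff_def)

lemma funpow_fdiff_zero [simp]: "(fdiff i ^^ k) (\<lambda>_. 0) = (\<lambda>_. 0)"
  by (induction k) auto

lemma mixed_diff_zero [simp]: "mixed_diff l d (\<lambda>_. 0) = (\<lambda>_. 0)"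
  by (induction l) auto

lemma fdiff_commute: "fdiff i (fdiff j F) = fdiff j (fdiff i F)"
  by (cases "i = j") (auto simp: fdiff_def fun_eq_iff fun_upd_twist algebra_simps)

lemma fdiff_funpow_commute: "fdiff i ((fdiff j ^^ k) F) = (fdiff j ^^ k) (fdiff i F)"
  by (induction k) (auto simp: fdiff_commute[of i])

lemma funpow_fdiff_commute:
  "(fdiff i ^^ k) ((fdiff j ^^ m) F) = (fdiff j ^^ m) ((fdiff i ^^ k) F)"
  by (induction k) (auto simp: fdiff_funpow_commute)

lemma funpow_fdiff_mixed_diff:
  "(fdiff i ^^ k) (mixed_diff l d F) = mixed_diff l d ((fdiff i ^^ k) F)"
  by (induction l) (auto simp: funpow_fdiff_commute[where i = i])

text \<open>
  Since forward differences commute, the additional order \<open>k\<close> may be pulled out of its place in the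
  list to the front.
\<close>

lemma mixed_diff_add_order:
  assumes "distinct l" "i \<in> set l"
  shows "mixed_diff l (d(i := d i + k)) F = (fdiff i ^^ k) (mixed_diff l d F)"
  using assms
proof (induction l)
  case (Cons j l)
  show ?case
  proof (cases "j = i")
    case True
    then have "mixed_diff l (d(i := d i + k)) F = mixed_diff l d F"
      using Cons.prems by (intro mixed_diff_cong) auto
    then have "mixed_diff (j # l) (d(i := d i + k)) F = (fdiff i ^^ (k + d i)) (mixed_diff l d F)"
      unfolding mixed_diff_Cons True fun_upd_same by (simp only: add.commute)
    also have "\<dots> = (fdiff i ^^ k) (mixed_diff (j # l) d F)"
      by (simp add: funpow_add True)
    finally show ?thesis .
  next
    case False
    with Cons show ?thesis
      by (simp add: funpow_fdiff_commute[where i = i])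
  qed
qed simp

text \<open>
  Equal first differences in the directions of \<open>I\<close> let the equality \<open>F x = G x\<close> be moved along one
  coordinate after the other, starting from the points that vanish on \<open>I\<close>.
\<close>

lemma eq_if_fdiff_eq:
  assumes "finite I"
    and "\<And>i. i \<in> I \<Longrightarrow> fdiff i F = fdiff i G"
    and "\<And>x. (\<And>i. i \<in> I \<Longrightarrow> x i = 0) \<Longrightarrow> F x = G x"
  shows "F = G"
  using assms
proof (induction I rule: finite_induct)
  case empty
  then show ?case by auto
next
  case (insert j I)
  have "F x = G x" if x: "\<And>i. i \<in> I \<Longrightarrow> x i = 0" for x
  proof -
    define y where "y k = x(j := k)" for k
    have step: "F (y (k + 1)) - F (y k) = G (y (k + 1)) - G (y k)" for k
      using fun_cong[OF insert.prems(1)[of j], of "x(j := k)"]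
      unfolding fdiff_def fun_upd_same fun_upd_upd y_def by blast
    have "F (y k) = G (y k)" for k
    proof (induction k rule: int_induct[where k = 0])
      case base
      show ?case by (rule insert.prems(2)) (use x in \<open>auto simp: y_def\<close>)
    next
      case (step1 k)
      then show ?case using step[of k] by simp
    next
      case (step2 k)
      then show ?case using step[of "k - 1"] by simp
    qed
    from this[of "x j"] show ?thesis by (simp add: y_def)
  qed
  with insert show ?case by auto
qed

text \<open>
  A function whose mixed differences of high order are known is determined by its mixed differences
  at the origin. The descending induction on the order is phrased as an induction on the distance
  from the order up to \<open>m + 1\<close>.
\<close>

lemma eq_if_mixed_diff_eq:
  assumes "distinct l"
    and high: "\<And>d. (\<Sum>i\<in>set l. d i) > m \<Longrightarrow> mixed_diff l d F = mixed_diff l d G"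
    and origin: "\<And>d x. (\<And>i. i \<in> set l \<Longrightarrow> x i = 0) \<Longrightarrow> mixed_diff l d F x = mixed_diff l d G x"
  shows "F = G"
proof -
  have "mixed_diff l d F = mixed_diff l d G" for d
  proof (induction "Suc m - (\<Sum>i\<in>set l. d i)" arbitrary: d rule: less_induct)
    case less
    show ?case
    proof (cases "(\<Sum>i\<in>set l. d i) > m")
      case False
      show ?thesis
      proof (rule eq_if_fdiff_eq[of "set l"])
        fix i assume i: "i \<in> set l"
        have "(\<Sum>j\<in>set l. (d(i := d i + 1)) j) = (\<Sum>j\<in>set l. d j) + 1"
          using i by (simp add: sum.remove[of _ i] del: One_nat_def)
        with False have "mixed_diff l (d(i := d i + 1)) F = mixed_diff l (d(i := d i + 1)) G"
          by (intro less) auto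
        then show "fdiff i (mixed_diff l d F) = fdiff i (mixed_diff l d G)"
          unfolding mixed_diff_add_order[OF assms(1) i] by simp
      qed (auto intro: origin)
    qed (rule high)
  qed
  from this[of "\<lambda>_. 0"] show ?thesis by (simp add: mixed_diff_order_zero)
qed

section \<open>Integer multiples and binomial products\<close>

lemma int_scale_zero_left [simp]: "int_scale 0 b = 0"
  by (simp add: int_scale_def)

lemma int_scale_one [simp]: "int_scale 1 b = b"
  by (simp add: int_scale_def)

lemma int_scale_add_one: "int_scale (k + 1) b = int_scale k b + b"
proof (cases "k \<ge> 0")
  case True
  then have "nat (k + 1) = Suc (nat k)" by simp
  with True show ?thesis by (simp add: int_scale_def)
next
  case False
  then have "nat (- k) = Suc (nat (- (k + 1)))" by simp
  with False show ?thesis by (simp add: int_scale_def)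
qed

lemma int_scale_add: "int_scale (j + k) b = int_scale j b + int_scale k b"
proof (induction k rule: int_induct[where k = 0])
  case base
  then show ?case by simp
next
  case (step1 k)
  then show ?case
    using int_scale_add_one[of "j + k" b] int_scale_add_one[of k b] by (simp add: algebra_simps)
next
  case (step2 k)
  then show ?case
    using int_scale_add_one[of "j + (k - 1)" b] int_scale_add_one[of "k - 1" b]
    by (simp add: algebra_simps)
qed

lemma int_scale_diff: "int_scale (j - k) b = int_scale j b - int_scale k b"
  using int_scale_add[of "j - k" k b] by simp

lemma fdiff_sum_int_scale:
  "fdiff i (\<lambda>x. \<Sum>s\<in>S. int_scale (g s x) (b s)) = (\<lambda>x. \<Sum>s\<in>S. int_scale (fdiff i (g s) x) (b s))"
  by (simp add: fdiff_def int_scale_diff sum_subtractf)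

lemma funpow_fdiff_sum_int_scale:
  "(fdiff i ^^ k) (\<lambda>x. \<Sum>s\<in>S. int_scale (g s x) (b s)) =
     (\<lambda>x. \<Sum>s\<in>S. int_scale ((fdiff i ^^ k) (g s) x) (b s))"
  by (induction k) (auto simp: fdiff_sum_int_scale)

lemma mixed_diff_sum_int_scale:
  "mixed_diff l d (\<lambda>x. \<Sum>s\<in>S. int_scale (g s x) (b s)) =
     (\<lambda>x. \<Sum>s\<in>S. int_scale (mixed_diff l d (g s) x) (b s))"
  by (induction l) (auto simp: funpow_fdiff_sum_int_scale)

lemma int_choose_0_right [simp]: "int_choose x 0 = 1"
  by (simp add: int_choose_def)

lemma int_choose_0_left: "int_choose 0 k = (if k = 0 then 1 else 0)"
proof (cases "k = 0")
  case False
  then have "(\<Prod>j = 0..<k. 0 - int j) = 0"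
    by (intro prod_zero) (auto intro!: bexI[of _ 0])
  with False show ?thesis unfolding int_choose_def by (simp only: if_False div_0)
qed simp

lemma int_choose_pascal: "int_choose (x + 1) (Suc k) = int_choose x k + int_choose x (Suc k)"
  using gbinomial_int_Suc_Suc[of x k] by (simp only: gbinomial_prod_rev int_choose_def of_nat_id)

definition binom_prod :: "'i set \<Rightarrow> ('i \<Rightarrow> nat) \<Rightarrow> ('i \<Rightarrow> int) \<Rightarrow> int" where
  "binom_prod I e = (\<lambda>x. \<Prod>i\<in>I. int_choose (x i) (e i))"

lemma binom_prod_cong:
  "(\<And>i. i \<in> I \<Longrightarrow> e i = e' i) \<Longrightarrow> (\<And>i. i \<in> I \<Longrightarrow> x i = y i) \<Longrightarrow> binom_prod I e x = binom_prod I e' y"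
  by (auto simp: binom_prod_def intro: prod.cong)

lemma binom_prod_origin:
  assumes "finite I" "\<And>i. i \<in> I \<Longrightarrow> x i = 0"
  shows "binom_prod I e x = (if \<forall>i\<in>I. e i = 0 then 1 else 0)"
proof -
  have "binom_prod I e x = (\<Prod>i\<in>I. if e i = 0 then 1 else 0)"
    unfolding binom_prod_def by (intro prod.cong) (auto simp: assms int_choose_0_left)
  then show ?thesis using assms(1) by auto
qed

lemma fdiff_binom_prod:
  assumes "finite I" "i \<in> I"
  shows "fdiff i (binom_prod I e) =
    (if e i = 0 then (\<lambda>_. 0) else binom_prod I (e(i := e i - 1)))"
proof -
  let ?R = "\<lambda>x. \<Prod>j\<in>I - {i}. int_choose (x j) (e j)"
  have upd: "(\<Prod>j\<in>I - {i}. int_choose ((x(i := y)) j) ((e(i := k)) j)) = ?R x" for x y k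
    by (intro prod.cong) auto
  have split: "binom_prod I (e(i := k)) (x(i := y)) = int_choose y k * ?R x" for x y k
    unfolding binom_prod_def prod.remove[OF assms] upd by simp
  have vals: "binom_prod I e (x(i := x i + 1)) = int_choose (x i + 1) (e i) * ?R x"
    "binom_prod I e x = int_choose (x i) (e i) * ?R x"
    "binom_prod I (e(i := k)) x = int_choose (x i) k * ?R x" for x k
    using split[of "e i" x "x i + 1"] split[of "e i" x "x i"] split[of k x "x i"]
    by (simp_all only: fun_upd_triv)
  show ?thesis
  proof (cases "e i")
    case 0
    have "fdiff i (binom_prod I e) x = 0" for x
      unfolding fdiff_def vals(1)[of x] vals(2)[of x] 0 by simp
    with 0 show ?thesis by auto
  next
    case (Suc k)
    have "fdiff i (binom_prod I e) x = binom_prod I (e(i := k)) x" for x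
      unfolding fdiff_def vals(1)[of x] vals(2)[of x] vals(3)[of k x] Suc
      by (simp only: int_choose_pascal distrib_right)
    with Suc show ?thesis by auto
  qed
qed

lemma funpow_fdiff_binom_prod:
  assumes "finite I" "i \<in> I"
  shows "(fdiff i ^^ k) (binom_prod I e) =
    (if k \<le> e i then binom_prod I (e(i := e i - k)) else (\<lambda>_. 0))"
proof (induction k)
  case (Suc k)
  then show ?case
    by (auto simp: fdiff_binom_prod[OF assms] intro!: ext binom_prod_cong)
qed simp

lemma mixed_diff_binom_prod:
  assumes "finite I" "distinct l" "set l \<subseteq> I"
  shows "mixed_diff l d (binom_prod I e) =
    (if \<forall>i\<in>set l. d i \<le> e i
     then binom_prod I (\<lambda>i. if i \<in> set l then e i - d i else e i) else (\<lambda>_. 0))"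
  using assms(2,3)
proof (induction l)
  case (Cons j l)
  let ?e = "\<lambda>l i. if i \<in> set l then e i - d i else e i"
  have j: "j \<in> I" "j \<notin> set l" using Cons.prems by auto
  have upd: "(?e l)(j := e j - d j) = ?e (j # l)" using j by auto
  show ?case
  proof (cases "\<forall>i\<in>set l. d i \<le> e i")
    case True
    then have "mixed_diff (j # l) d (binom_prod I e) = (fdiff j ^^ d j) (binom_prod I (?e l))"
      using Cons by simp
    also have "\<dots> = (if d j \<le> e j then binom_prod I ((?e l)(j := e j - d j)) else (\<lambda>_. 0))"
      unfolding funpow_fdiff_binom_prod[OF assms(1) j(1)] using j by simp
    finally show ?thesis using True unfolding upd by simp
  next
    case False
    then show ?thesis using Cons by auto
  qed
qed simp

section \<open>Differences of polyfracts\<close>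

definition polyfract_fun ::
  "nat \<Rightarrow> ((nat \<Rightarrow>\<^sub>0 nat) \<Rightarrow>\<^sub>0 'b::ab_group_add) \<Rightarrow> (nat \<Rightarrow> int) \<Rightarrow> 'b" where
  "polyfract_fun n P = (\<lambda>x. \<Sum>\<delta>\<in>Poly_Mapping.keys P.
     int_scale (binom_prod {1..n} (Poly_Mapping.lookup \<delta>) x) (Poly_Mapping.lookup P \<delta>))"

lemma polyfract_map_eq_restrict: "polyfract_map n P = restrict (polyfract_fun n P) (int_tuples n)"
  by (simp add: polyfract_map_def polyfract_fun_def binom_prod_def)

lemma polyfract_fun_cong:
  "(\<And>i. i \<in> {1..n} \<Longrightarrow> x i = y i) \<Longrightarrow> polyfract_fun n P x = polyfract_fun n P y"
  unfolding polyfract_fun_def by (intro sum.cong refl arg_cong2[where f = int_scale] binom_prod_cong)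

lemma mixed_diff_polyfract_fun:
  assumes "distinct l" "set l \<subseteq> {1..n}"
  shows "mixed_diff l d (polyfract_fun n P) = (\<lambda>x. \<Sum>\<delta>\<in>Poly_Mapping.keys P.
    int_scale (if \<forall>i\<in>set l. d i \<le> Poly_Mapping.lookup \<delta> i
               then binom_prod {1..n} (\<lambda>i. if i \<in> set l
                      then Poly_Mapping.lookup \<delta> i - d i else Poly_Mapping.lookup \<delta> i) x
               else 0) (Poly_Mapping.lookup P \<delta>))"
  unfolding polyfract_fun_def mixed_diff_sum_int_scale
    mixed_diff_binom_prod[OF finite_atLeastAtMost assms]
  by (auto simp: fun_eq_iff intro!: sum.cong)

lemma mixed_diff_polyfract_fun_eq_zero:
  assumes "distinct l" "set l \<subseteq> {1..n}"
    and "\<And>\<delta>. \<delta> \<in> Poly_Mapping.keys P \<Longrightarrow> \<exists>i\<in>set l. Poly_Mapping.lookup \<delta> i < d i"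
  shows "mixed_diff l d (polyfract_fun n P) = (\<lambda>_. 0)"
proof -
  have "\<not> (\<forall>i\<in>set l. d i \<le> Poly_Mapping.lookup \<delta> i)" if "\<delta> \<in> Poly_Mapping.keys P" for \<delta>
    using assms(3)[OF that] by (auto simp: not_le)
  then show ?thesis
    unfolding mixed_diff_polyfract_fun[OF assms(1,2)] 
    by (intro ext sum.neutral ballI) (simp only: if_False int_scale_zero_left)
qed

text \<open>
  The difference of order \<open>\<delta>\<close> turns the term of exponent \<open>\<epsilon>\<close> into the one of exponent \<open>\<epsilon> - \<delta>\<close>, or
  kills it. At the origin every remaining positive exponent gives \<open>0\<close>, so only \<open>\<epsilon> = \<delta>\<close> contributes.
\<close>

lemma mixed_diff_polyfract_fun_origin:
  assumes P: "P \<in> polyfracts n" and \<delta>: "Poly_Mapping.keys \<delta> \<subseteq> {1..n}"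
    and x: "\<And>i. i \<in> {1..n} \<Longrightarrow> x i = 0"
  shows "mixed_diff [1..<Suc n] (Poly_Mapping.lookup \<delta>) (polyfract_fun n P) x =
    Poly_Mapping.lookup P \<delta>"
proof -
  have l: "set [1..<Suc n] = {1..n}" by auto
  let ?t = "\<lambda>\<epsilon>. int_scale (if \<forall>i\<in>{1..n}. Poly_Mapping.lookup \<delta> i \<le> Poly_Mapping.lookup \<epsilon> i
    then binom_prod {1..n} (\<lambda>i. if i \<in> {1..n}
      then Poly_Mapping.lookup \<epsilon> i - Poly_Mapping.lookup \<delta> i else Poly_Mapping.lookup \<epsilon> i) x
    else 0) (Poly_Mapping.lookup P \<epsilon>)"
  have t: "?t \<epsilon> = (if \<epsilon> = \<delta> then Poly_Mapping.lookup P \<epsilon> else 0)"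
    if "\<epsilon> \<in> Poly_Mapping.keys P" for \<epsilon>
  proof (cases "\<epsilon> = \<delta>")
    case True
    then show ?thesis by (subst binom_prod_origin) (auto simp: x)
  next
    case False
    have "Poly_Mapping.keys \<epsilon> \<subseteq> {1..n}" using P that by (auto simp: polyfracts_def)
    have "\<exists>i\<in>{1..n}. Poly_Mapping.lookup \<epsilon> i \<noteq> Poly_Mapping.lookup \<delta> i"
    proof (rule ccontr)
      assume eq: "\<not> ?thesis"
      have "Poly_Mapping.lookup \<epsilon> i = Poly_Mapping.lookup \<delta> i" for i
      proof (cases "i \<in> {1..n}")
        case False
        then have "i \<notin> Poly_Mapping.keys \<epsilon>" "i \<notin> Poly_Mapping.keys \<delta>"
          using \<delta> \<open>Poly_Mapping.keys \<epsilon> \<subseteq> {1..n}\<close> by auto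
        then show ?thesis by (simp add: in_keys_iff)
      qed (use eq in auto)
      with False show False by (auto intro: poly_mapping_eqI)
    qed
    then obtain i where i: "i \<in> {1..n}" "Poly_Mapping.lookup \<epsilon> i \<noteq> Poly_Mapping.lookup \<delta> i" by blast
    show ?thesis
    proof (cases "\<forall>i\<in>{1..n}. Poly_Mapping.lookup \<delta> i \<le> Poly_Mapping.lookup \<epsilon> i")
      case True
      then have "Poly_Mapping.lookup \<epsilon> i - Poly_Mapping.lookup \<delta> i \<noteq> 0" using i by force
      then have "binom_prod {1..n} (\<lambda>i. if i \<in> {1..n}
          then Poly_Mapping.lookup \<epsilon> i - Poly_Mapping.lookup \<delta> i else Poly_Mapping.lookup \<epsilon> i) x = 0"
        using i(1) by (subst binom_prod_origin) (auto simp: x)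
      then show ?thesis using False by simp
    next
      case notle: False
      then show ?thesis using False by (simp only: if_False int_scale_zero_left)
    qed
  qed
  have "mixed_diff [1..<Suc n] (Poly_Mapping.lookup \<delta>) (polyfract_fun n P) x =
      (\<Sum>\<epsilon>\<in>Poly_Mapping.keys P. ?t \<epsilon>)"
    by (subst mixed_diff_polyfract_fun[where n = n]) (simp_all only: l distinct_upt subset_refl)
  also have "\<dots> = (\<Sum>\<epsilon>\<in>Poly_Mapping.keys P. if \<epsilon> = \<delta> then Poly_Mapping.lookup P \<epsilon> else 0)"
    by (rule sum.cong[OF refl t])
  also have "\<dots> = Poly_Mapping.lookup P \<delta>"
    by (simp add: sum.delta in_keys_iff)
  finally show ?thesis .
qed

section \<open>The Newton polyfract\<close>

lemma poly_mapping_with_values: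
  assumes "finite K"
  obtains P where "\<And>k. Poly_Mapping.lookup P k = (if k \<in> K then c k else 0)"
proof -
  have "finite {k. (if k \<in> K then c k else 0) \<noteq> 0}"
    by (rule finite_subset[OF _ assms]) (auto split: if_splits)
  then have "Poly_Mapping.lookup (Abs_poly_mapping (\<lambda>k. if k \<in> K then c k else 0)) k =
      (if k \<in> K then c k else 0)" for k
    by (simp add: lookup_Abs_poly_mapping)
  then show ?thesis by (rule that)
qed

lemma finite_bounded_exponents:
  "finite {\<delta> :: nat \<Rightarrow>\<^sub>0 nat. Poly_Mapping.keys \<delta> \<subseteq> {1..n} \<and> (\<Sum>i\<in>{1..n}. Poly_Mapping.lookup \<delta> i) \<le> m}"
    (is "finite ?K")
proof (rule inj_on_finite[where f = Poly_Mapping.lookup])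
  show "inj_on Poly_Mapping.lookup ?K"
    by (auto intro: inj_onI poly_mapping_eqI)
  let ?S = "{f. \<forall>i. (i \<in> {1..n} \<longrightarrow> f i \<in> {..m}) \<and> (i \<notin> {1..n} \<longrightarrow> f i = 0)}"
  show "Poly_Mapping.lookup ` ?K \<subseteq> ?S"
  proof safe
    fix \<delta> :: "nat \<Rightarrow>\<^sub>0 nat" and i
    assume *: "Poly_Mapping.keys \<delta> \<subseteq> {1..n}" "(\<Sum>i\<in>{1..n}. Poly_Mapping.lookup \<delta> i) \<le> m"
    show "Poly_Mapping.lookup \<delta> i \<le> m" if "i \<in> {1..n}"
      using member_le_sum[OF that, of "Poly_Mapping.lookup \<delta>"] *(2) by simp
    show "Poly_Mapping.lookup \<delta> i = 0" if "i \<notin> {1..n}"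
      using *(1) that by (auto simp: in_keys_iff)
  qed
  show "finite ?S" by (rule finite_set_of_finite_funs) auto
qed

text \<open>
  The hypothesis \<open>origin\<close> holds for every \<open>F\<close> that depends only on the coordinates in \<open>{1..n}\<close>: all
  points that vanish there represent the origin, and a Newton coefficient must not depend on the
  choice among them.
\<close>

lemma newton_polyfract:
  fixes F :: "(nat \<Rightarrow> int) \<Rightarrow> 'b::ab_group_add"
  assumes high: "\<And>d. (\<Sum>i\<in>{1..n}. d i) > m \<Longrightarrow> mixed_diff [1..<Suc n] d F = (\<lambda>_. 0)"
    and origin: "\<And>d x. (\<And>i. i \<in> {1..n} \<Longrightarrow> x i = 0) \<Longrightarrow>
      mixed_diff [1..<Suc n] d F x = mixed_diff [1..<Suc n] d F (\<lambda>_. 0)"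
  obtains P where "P \<in> polyfracts n" "polyfract_fun n P = F"
proof -
  have l: "set [1..<Suc n] = {1..n}" by auto
  define K where "K = {\<delta> :: nat \<Rightarrow>\<^sub>0 nat. Poly_Mapping.keys \<delta> \<subseteq> {1..n} \<and>
    (\<Sum>i\<in>{1..n}. Poly_Mapping.lookup \<delta> i) \<le> m}"
  have "finite K" unfolding K_def by (rule finite_bounded_exponents)
  then obtain P where P: "\<And>\<delta>. Poly_Mapping.lookup P \<delta> =
      (if \<delta> \<in> K then mixed_diff [1..<Suc n] (Poly_Mapping.lookup \<delta>) F (\<lambda>_. 0) else 0)"
    by (rule poly_mapping_with_values[where c =
          "\<lambda>\<delta>. mixed_diff [1..<Suc n] (Poly_Mapping.lookup \<delta>) F (\<lambda>_. 0)"]) blast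
  have keys: "Poly_Mapping.keys P \<subseteq> K"
    by (auto simp: in_keys_iff P split: if_splits)
  then have Pn: "P \<in> polyfracts n"
    by (auto simp: polyfracts_def K_def)
  have highP: "mixed_diff [1..<Suc n] d (polyfract_fun n P) = (\<lambda>_. 0)"
    if d: "(\<Sum>i\<in>{1..n}. d i) > m" for d
  proof (rule mixed_diff_polyfract_fun_eq_zero)
    fix \<delta> assume "\<delta> \<in> Poly_Mapping.keys P"
    then have "(\<Sum>i\<in>{1..n}. Poly_Mapping.lookup \<delta> i) \<le> m" using keys by (auto simp: K_def)
    with d have "\<not> (\<forall>i\<in>{1..n}. d i \<le> Poly_Mapping.lookup \<delta> i)"
      using sum_mono[of "{1..n}" d "Poly_Mapping.lookup \<delta>"] by fastforce
    then show "\<exists>i\<in>set [1..<Suc n]. Poly_Mapping.lookup \<delta> i < d i" unfolding l by (auto simp: not_le)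
  qed (auto simp only: l distinct_upt)
  have "polyfract_fun n P = F"
  proof (rule eq_if_mixed_diff_eq[of "[1..<Suc n]" m], unfold l)
    show "distinct [1..<Suc n]" by simp
    show "mixed_diff [1..<Suc n] d (polyfract_fun n P) = mixed_diff [1..<Suc n] d F"
      if "m < (\<Sum>i\<in>{1..n}. d i)" for d
      using high[OF that] highP[OF that] by simp
    show "mixed_diff [1..<Suc n] d (polyfract_fun n P) x = mixed_diff [1..<Suc n] d F x"
      if x: "\<And>i. i \<in> {1..n} \<Longrightarrow> x i = 0" for d x
    proof (cases "(\<Sum>i\<in>{1..n}. d i) > m")
      case True
      then show ?thesis using high highP by simp
    next
      case False
      obtain \<delta> where \<delta>: "\<And>i. Poly_Mapping.lookup \<delta> i = (if i \<in> {1..n} then d i else 0)"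
        by (rule poly_mapping_with_values[of "{1..n}" d]) auto
      have k: "Poly_Mapping.keys \<delta> \<subseteq> {1..n}" by (auto simp: in_keys_iff \<delta> split: if_splits)
      have "\<delta> \<in> K" using k False by (simp add: K_def \<delta>)
      have d: "mixed_diff [1..<Suc n] d G = mixed_diff [1..<Suc n] (Poly_Mapping.lookup \<delta>) G"
        for G :: "(nat \<Rightarrow> int) \<Rightarrow> 'b"
        by (rule mixed_diff_cong) (auto simp: \<delta>)
      have "mixed_diff [1..<Suc n] d (polyfract_fun n P) x = Poly_Mapping.lookup P \<delta>"
        unfolding d by (rule mixed_diff_polyfract_fun_origin[OF Pn k x])
      also have "\<dots> = mixed_diff [1..<Suc n] d F (\<lambda>_. 0)"
        using P \<open>\<delta> \<in> K\<close> d by simp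
      also have "\<dots> = mixed_diff [1..<Suc n] d F x"
        using origin[of x d, OF x] by simp
      finally show ?thesis .
    qed
  qed
  with Pn show ?thesis by (rule that)
qed

section \<open>Pulling maps on the product back to integer points\<close>

definition reduce :: "nat \<Rightarrow> (nat \<Rightarrow> nat) \<Rightarrow> (nat \<Rightarrow> int) \<Rightarrow> nat \<Rightarrow> int" where
  "reduce n q x = (\<lambda>i\<in>{1..n}. x i mod int (q i))"

definition pullback :: "nat \<Rightarrow> (nat \<Rightarrow> nat) \<Rightarrow> ((nat \<Rightarrow> int) \<Rightarrow> 'b) \<Rightarrow> (nat \<Rightarrow> int) \<Rightarrow> 'b" where
  "pullback n q f = (\<lambda>x. f (reduce n q x))"

lemma carrier_domain_group:
  "carrier (domain_group n q) = (\<Pi>\<^sub>E i\<in>{1..n}. if q i = 0 then UNIV else {0..<int (q i)})"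
  by (simp add: domain_group_def carrier_integer_mod_group)

lemma reduce_in_carrier: "reduce n q x \<in> carrier (domain_group n q)"
  by (auto simp: carrier_domain_group reduce_def)

lemma reduce_carrier:
  assumes x: "x \<in> carrier (domain_group n q)"
  shows "reduce n q x = x"
proof
  fix i
  show "reduce n q x i = x i"
  proof (cases "i \<in> {1..n}")
    case True
    then have "x i \<in> (if q i = 0 then UNIV else {0..<int (q i)})"
      using x by (auto simp: carrier_domain_group PiE_iff)
    with True show ?thesis by (auto simp: reduce_def split: if_splits)
  next
    case False
    then show ?thesis
      using x PiE_arb[of x "{1..n}" _ i] by (auto simp: reduce_def carrier_domain_group)
  qed
qed

lemma reduce_cong: "(\<And>i. i \<in> {1..n} \<Longrightarrow> x i = y i) \<Longrightarrow> reduce n q x = reduce n q y"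
  by (auto simp: reduce_def)

lemma reduce_shift:
  "i \<in> {1..n} \<Longrightarrow> reduce n q (x(i := x i + 1)) = reduce n q x \<otimes>\<^bsub>domain_group n q\<^esub> unit_tuple n q i"
  by (auto simp: reduce_def domain_group_def unit_tuple_def fun_eq_iff mod_simps)

lemma pullback_\<Delta>: "i \<in> {1..n} \<Longrightarrow> pullback n q (\<Delta> n q i f) = fdiff i (pullback n q f)"
  by (simp add: pullback_def \<Delta>_def fdiff_def reduce_shift)

lemma pullback_funpow_\<Delta>:
  "i \<in> {1..n} \<Longrightarrow> pullback n q ((\<Delta> n q i ^^ k) f) = (fdiff i ^^ k) (pullback n q f)"
  by (induction k) (auto simp: pullback_\<Delta>)

lemma pullback_iterated_\<Delta>:
  "pullback n q (iterated_\<Delta> n q d f) = mixed_diff [1..<Suc n] d (pullback n q f)"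
proof -
  have "pullback n q (foldr (\<lambda>i. \<Delta> n q i ^^ d i) l f) = mixed_diff l d (pullback n q f)"
    if "set l \<subseteq> {1..n}" for l
    using that by (induction l) (auto simp: pullback_funpow_\<Delta>)
  from this[of "[1..<Suc n]"] show ?thesis
    by (simp add: iterated_\<Delta>_def atLeastLessThanSuc_atLeastAtMost)
qed

lemma vanishes_iff_pullback: "vanishes n q f \<longleftrightarrow> pullback n q f = (\<lambda>_. 0)"
  unfolding vanishes_def pullback_def fun_eq_iff by (metis reduce_in_carrier reduce_carrier)

lemma Fdeg_eq_pullback:
  "Fdeg n q f = least_or_infinity (\<lambda>m. \<forall>d. (\<Sum>i\<in>{1..n}. d i) > m \<longrightarrow>
     mixed_diff [1..<Suc n] d (pullback n q f) = (\<lambda>_. 0))"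
  by (simp only: Fdeg_def vanishes_iff_pullback pullback_iterated_\<Delta>)

lemma Pdeg_eq_pullback:
  "i \<in> {1..n} \<Longrightarrow>
    Pdeg n q i f = least_or_infinity (\<lambda>m. (fdiff i ^^ (m + 1)) (pullback n q f) = (\<lambda>_. 0))"
  by (simp only: Pdeg_def vanishes_iff_pullback pullback_funpow_\<Delta>)

lemma restrict_int_tuple: "restrict x {1..n} \<in> int_tuples n"
  by (auto simp: int_tuples_def)

lemma periodic_lift_eq_restrict: "periodic_lift n q f = restrict (pullback n q f) (int_tuples n)"
  by (simp add: periodic_lift_def pullback_def reduce_def)

lemma periodic_lift_eq_polyfract_map_iff:
  "periodic_lift n q f = polyfract_map n P \<longleftrightarrow> pullback n q f = polyfract_fun n P"
proof
  assume "periodic_lift n q f = polyfract_map n P"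
  then have eq: "pullback n q f x = polyfract_fun n P x" if "x \<in> int_tuples n" for x
    using that unfolding periodic_lift_eq_restrict polyfract_map_eq_restrict
    by (metis restrict_apply')
  show "pullback n q f = polyfract_fun n P"
  proof
    fix x
    have "pullback n q f x = pullback n q f (restrict x {1..n})"
      unfolding pullback_def by (rule arg_cong[where f = f], rule reduce_cong) simp
    also have "\<dots> = polyfract_fun n P (restrict x {1..n})"
      by (rule eq[OF restrict_int_tuple])
    also have "\<dots> = polyfract_fun n P x"
      by (rule polyfract_fun_cong) simp
    finally show "pullback n q f x = polyfract_fun n P x" .
  qed
qed (simp add: periodic_lift_eq_restrict polyfract_map_eq_restrict)

lemma fun_upd_int_tuple: "x \<in> int_tuples n \<Longrightarrow> i \<in> {1..n} \<Longrightarrow> x(i := k) \<in> int_tuples n"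
  by (auto simp: int_tuples_def PiE_iff extensional_def)

lemma periodic_periodic_lift: "periodic n q (periodic_lift n q f)"
  unfolding periodic_def
proof (intro ballI)
  fix x i assume "x \<in> int_tuples n" "i \<in> {1..n}"
  moreover have "reduce n q (x(i := x i + int (q i))) = reduce n q x"
    by (auto simp: reduce_def)
  ultimately show "periodic_lift n q f (x(i := x i + int (q i))) = periodic_lift n q f x"
    by (simp add: periodic_lift_eq_restrict pullback_def fun_upd_int_tuple)
qed

text \<open>
  Periodicity moves one coordinate by a single period; iterating it over all integer multiples and
  then over the coordinates reaches the representative with all residues.
\<close>

lemma periodic_polyfract_fun_reduce:
  assumes "periodic n q (polyfract_map n P)"
  shows "polyfract_fun n P (reduce n q x) = polyfract_fun n P x"
proof -
  have shift: "polyfract_fun n P (x(i := x i + int (q i))) = polyfract_fun n P x"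
    if i: "i \<in> {1..n}" for x i
  proof -
    let ?y = "restrict x {1..n}"
    have "polyfract_fun n P (x(i := x i + int (q i))) = polyfract_fun n P (?y(i := ?y i + int (q i)))"
      by (rule polyfract_fun_cong) (use i in auto)
    also have "\<dots> = polyfract_fun n P ?y"
      using assms i restrict_int_tuple[of x n] fun_upd_int_tuple[OF restrict_int_tuple i, of x]
      unfolding periodic_def polyfract_map_eq_restrict by (metis restrict_apply')
    also have "\<dots> = polyfract_fun n P x"
      by (rule polyfract_fun_cong) simp
    finally show ?thesis .
  qed
  have multiple: "polyfract_fun n P (x(i := x i + k * int (q i))) = polyfract_fun n P x"
    if i: "i \<in> {1..n}" for x i k
  proof -
    define y where "y k = x(i := x i + k * int (q i))" for k
    have y: "(y k)(i := y k i + int (q i)) = y (k + 1)" for k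
      by (simp add: y_def fun_eq_iff distrib_right)
    have step: "polyfract_fun n P (y (k + 1)) = polyfract_fun n P (y k)" for k
      using shift[OF i, of "y k"] unfolding y .
    have "polyfract_fun n P (y k) = polyfract_fun n P (y 0)"
    proof (induction k rule: int_induct[where k = 0])
      case (step1 k)
      then show ?case using step[of k] by simp
    next
      case (step2 k)
      then show ?case using step[of "k - 1"] by simp
    qed simp
    then show ?thesis by (simp add: y_def)
  qed
  have "polyfract_fun n P (\<lambda>i. if i \<in> J then x i mod int (q i) else x i) = polyfract_fun n P x"
    if "finite J" "J \<subseteq> {1..n}" for J
    using that
  proof (induction J rule: finite_induct)
    case (insert j J)
    let ?y = "\<lambda>J i. if i \<in> J then x i mod int (q i) else x i"
    have "(?y J)(j := ?y J j + (- (x j div int (q j))) * int (q j)) = ?y (insert j J)"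
      using insert.hyps by (auto simp: minus_div_mult_eq_mod fun_eq_iff)
    then show ?case
      using insert multiple[of j "?y J" "- (x j div int (q j))"] by simp
  qed simp
  from this[of "{1..n}"]
  have "polyfract_fun n P (\<lambda>i. if i \<in> {1..n} then x i mod int (q i) else x i) = polyfract_fun n P x"
    by simp
  moreover have "polyfract_fun n P (reduce n q x) =
      polyfract_fun n P (\<lambda>i. if i \<in> {1..n} then x i mod int (q i) else x i)"
    by (rule polyfract_fun_cong) (simp add: reduce_def)
  ultimately show ?thesis by simp
qed

section \<open>Functional degrees of polyfracts\<close>

lemma least_or_infinity_eqI:
  "Q k \<Longrightarrow> (\<And>m. Q m \<Longrightarrow> k \<le> m) \<Longrightarrow> least_or_infinity Q = enat k"
  by (auto simp: least_or_infinity_def intro: Least_equality)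

lemma total_deg_ge:
  "\<delta> \<in> Poly_Mapping.keys P \<Longrightarrow> (\<Sum>i\<in>{1..n}. Poly_Mapping.lookup \<delta> i) \<le> total_deg n P"
  by (auto simp: total_deg_def)

lemma total_deg_attained:
  assumes "P \<noteq> 0"
  obtains \<delta> where "\<delta> \<in> Poly_Mapping.keys P" "(\<Sum>i\<in>{1..n}. Poly_Mapping.lookup \<delta> i) = total_deg n P"
proof -
  have "total_deg n P \<in> (\<lambda>\<delta>. \<Sum>i\<in>{1..n}. Poly_Mapping.lookup \<delta> i) ` Poly_Mapping.keys P"
    using assms by (auto simp: total_deg_def intro!: Max_in)
  then show ?thesis using that by auto
qed

lemma partial_deg_ge: "\<delta> \<in> Poly_Mapping.keys P \<Longrightarrow> Poly_Mapping.lookup \<delta> i \<le> partial_deg i P"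
  by (auto simp: partial_deg_def)

lemma partial_deg_attained:
  assumes "P \<noteq> 0"
  obtains \<delta> where "\<delta> \<in> Poly_Mapping.keys P" "Poly_Mapping.lookup \<delta> i = partial_deg i P"
proof -
  have "partial_deg i P \<in> (\<lambda>\<delta>. Poly_Mapping.lookup \<delta> i) ` Poly_Mapping.keys P"
    using assms by (auto simp: partial_deg_def intro!: Max_in)
  then show ?thesis using that by auto
qed

lemma mixed_diff_polyfract_fun_nonzero:
  assumes "P \<in> polyfracts n" "\<delta> \<in> Poly_Mapping.keys P"
  shows "mixed_diff [1..<Suc n] (Poly_Mapping.lookup \<delta>) (polyfract_fun n P) \<noteq> (\<lambda>_. 0)"
proof
  assume "mixed_diff [1..<Suc n] (Poly_Mapping.lookup \<delta>) (polyfract_fun n P) = (\<lambda>_. 0)"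
  moreover have "Poly_Mapping.keys \<delta> \<subseteq> {1..n}" using assms by (auto simp: polyfracts_def)
  ultimately have "Poly_Mapping.lookup P \<delta> = 0"
    using mixed_diff_polyfract_fun_origin[OF assms(1), of \<delta> "\<lambda>_. 0"] by simp
  with assms(2) show False by (simp add: in_keys_iff)
qed

lemma Fdeg_eq_total_deg:
  assumes "P \<in> polyfracts n" and f: "pullback n q f = polyfract_fun n P"
  shows "Fdeg n q f = enat (total_deg n P)"
  unfolding Fdeg_eq_pullback f
proof (rule least_or_infinity_eqI, intro allI impI)
  fix d :: "nat \<Rightarrow> nat"
  assume d: "total_deg n P < (\<Sum>i\<in>{1..n}. d i)"
  show "mixed_diff [1..<Suc n] d (polyfract_fun n P) = (\<lambda>_. 0)"
  proof (rule mixed_diff_polyfract_fun_eq_zero)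
    fix \<delta> assume "\<delta> \<in> Poly_Mapping.keys P"
    then have "(\<Sum>i\<in>{1..n}. Poly_Mapping.lookup \<delta> i) < (\<Sum>i\<in>{1..n}. d i)"
      using total_deg_ge[of \<delta> P n] d by linarith
    then have "\<not> (\<forall>i\<in>{1..n}. d i \<le> Poly_Mapping.lookup \<delta> i)"
      using sum_mono[of "{1..n}" d "Poly_Mapping.lookup \<delta>"] by fastforce
    then show "\<exists>i\<in>set [1..<Suc n]. Poly_Mapping.lookup \<delta> i < d i" by (auto simp: not_le)
  qed auto
next
  fix m
  assume m: "\<forall>d. m < (\<Sum>i\<in>{1..n}. d i) \<longrightarrow>
    mixed_diff [1..<Suc n] d (polyfract_fun n P) = (\<lambda>_. 0)"
  show "total_deg n P \<le> m"
  proof (rule ccontr)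
    assume less: "\<not> total_deg n P \<le> m"
    then have "P \<noteq> 0" by (auto simp: total_deg_def)
    then obtain \<delta> where \<delta>: "\<delta> \<in> Poly_Mapping.keys P"
      "(\<Sum>i\<in>{1..n}. Poly_Mapping.lookup \<delta> i) = total_deg n P"
      by (rule total_deg_attained)
    then have "mixed_diff [1..<Suc n] (Poly_Mapping.lookup \<delta>) (polyfract_fun n P) = (\<lambda>_. 0)"
      using m less by simp
    with mixed_diff_polyfract_fun_nonzero[OF assms(1) \<delta>(1)] show False by contradiction
  qed
qed

text \<open>
  For the lower bound, a vanishing \<open>i\<close>-th difference of order at most \<open>\<delta> i\<close> can be split off the mixed
  difference of order \<open>\<delta>\<close>, which would then vanish although \<open>b\<^sub>\<delta> \<noteq> 0\<close>.
\<close>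

lemma Pdeg_eq_partial_deg:
  assumes "P \<in> polyfracts n" and f: "pullback n q f = polyfract_fun n P" and i: "i \<in> {1..n}"
  shows "Pdeg n q i f = enat (partial_deg i P)"
  unfolding Pdeg_eq_pullback[OF i] f
proof (rule least_or_infinity_eqI)
  have "mixed_diff [i] (\<lambda>_. partial_deg i P + 1) (polyfract_fun n P) = (\<lambda>_. 0)"
    using i partial_deg_ge[of _ P i]
    by (intro mixed_diff_polyfract_fun_eq_zero) (auto simp: less_Suc_eq_le)
  then show "(fdiff i ^^ (partial_deg i P + 1)) (polyfract_fun n P) = (\<lambda>_. 0)" by simp
next
  fix m
  assume m: "(fdiff i ^^ (m + 1)) (polyfract_fun n P) = (\<lambda>_. 0)"
  show "partial_deg i P \<le> m"
  proof (rule ccontr)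
    assume less: "\<not> partial_deg i P \<le> m"
    then have "P \<noteq> 0" by (auto simp: partial_deg_def)
    then obtain \<delta> where \<delta>: "\<delta> \<in> Poly_Mapping.keys P" "Poly_Mapping.lookup \<delta> i = partial_deg i P"
      by (rule partial_deg_attained)
    define d where "d = (Poly_Mapping.lookup \<delta>)(i := Poly_Mapping.lookup \<delta> i - (m + 1))"
    have "Poly_Mapping.lookup \<delta> = d(i := d i + (m + 1))"
      using less \<delta>(2) by (auto simp: d_def)
    moreover have "mixed_diff [1..<Suc n] (d(i := d i + (m + 1))) (polyfract_fun n P) =
        mixed_diff [1..<Suc n] d ((fdiff i ^^ (m + 1)) (polyfract_fun n P))"
      using i by (subst mixed_diff_add_order) (auto simp only: funpow_fdiff_mixed_diff
          distinct_upt set_upt atLeastLessThanSuc_atLeastAtMost)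
    ultimately have "mixed_diff [1..<Suc n] (Poly_Mapping.lookup \<delta>) (polyfract_fun n P) = (\<lambda>_. 0)"
      unfolding m by simp
    with mixed_diff_polyfract_fun_nonzero[OF assms(1) \<delta>(1)] show False by contradiction
  qed
qed

lemma polyfract_if_Fdeg_finite:
  assumes "Fdeg n q f < \<infinity>"
  obtains P where "P \<in> polyfracts n" "polyfract_fun n P = pullback n q f"
proof -
  obtain m where m: "\<And>d. (\<Sum>i\<in>{1..n}. d i) > m \<Longrightarrow>
      mixed_diff [1..<Suc n] d (pullback n q f) = (\<lambda>_. 0)"
    using assms by (auto simp: Fdeg_eq_pullback least_or_infinity_def split: if_splits)
  have origin: "mixed_diff [1..<Suc n] d (pullback n q f) x =
      mixed_diff [1..<Suc n] d (pullback n q f) (\<lambda>_. 0)"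
    if "\<And>i. i \<in> {1..n} \<Longrightarrow> x i = 0" for d x
  proof -
    have "reduce n q x = reduce n q (\<lambda>_. 0)" using that by (rule reduce_cong)
    then show ?thesis
      unfolding pullback_iterated_\<Delta>[symmetric] by (simp add: pullback_def)
  qed
  show ?thesis
    by (rule newton_polyfract[of m n "pullback n q f"]) (fact m origin that)+
qed

theorem corollary3p6:
  fixes n :: nat and q :: "nat \<Rightarrow> nat"
  assumes "n \<ge> 1"
  shows "periodic_lift n q ` {f \<in> maps n q. Fdeg n q f < \<infinity>} =
           polyfract_map n ` {P :: (nat \<Rightarrow>\<^sub>0 nat) \<Rightarrow>\<^sub>0 'b::ab_group_add.
             P \<in> polyfracts n \<and> periodic n q (polyfract_map n P)} \<and>
         (\<forall>f \<in> maps n q. \<forall>P :: (nat \<Rightarrow>\<^sub>0 nat) \<Rightarrow>\<^sub>0 'b.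
           P \<in> polyfracts n \<and> periodic_lift n q f = polyfract_map n P \<longrightarrow>
             Fdeg n q f = enat (total_deg n P) \<and>
             (\<forall>i\<in>{1..n}. Pdeg n q i f = enat (partial_deg i P)))"
    (is "?L = ?R \<and> ?degrees")
proof (intro conjI equalityI subsetI)
  fix F assume "F \<in> ?L"
  then obtain f where F: "F = periodic_lift n q f" and f: "Fdeg n q f < \<infinity>" by auto
  from f obtain P where P: "P \<in> polyfracts n" "polyfract_fun n P = pullback n q f"
    by (rule polyfract_if_Fdeg_finite)
  then have "F = polyfract_map n P"
    by (simp add: F periodic_lift_eq_polyfract_map_iff)
  moreover have "periodic n q F" unfolding F by (rule periodic_periodic_lift)
  ultimately show "F \<in> ?R" using P(1) by auto
next
  fix F assume "F \<in> ?R"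
  then obtain P :: "(nat \<Rightarrow>\<^sub>0 nat) \<Rightarrow>\<^sub>0 'b" where F: "F = polyfract_map n P"
    and P: "P \<in> polyfracts n" "periodic n q (polyfract_map n P)" by auto
  define f where "f = restrict (polyfract_fun n P) (carrier (domain_group n q))"
  have "f \<in> maps n q" by (simp add: f_def maps_def)
  moreover have f: "pullback n q f = polyfract_fun n P"
    by (simp add: pullback_def f_def reduce_in_carrier periodic_polyfract_fun_reduce[OF P(2)])
  then have "F = periodic_lift n q f"
    by (simp add: F periodic_lift_eq_polyfract_map_iff[THEN iffD2])
  moreover have "Fdeg n q f < \<infinity>"
    using Fdeg_eq_total_deg[OF P(1) f] by simp
  ultimately show "F \<in> ?L" by auto
next
  show ?degrees
    by (auto simp: periodic_lift_eq_polyfract_map_iff intro: Fdeg_eq_total_deg Pdeg_eq_partial_deg)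
qed

end
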